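(* For every integer $n\ge 0$, as an identity of polynomials in $x$ (with coefficients rational functions of $q$), \[ \prod_{j=1}^n (1+2xq^{2j-1}+q^{4j-2})=\sum_{j=0}^n q^{j^2}{2n \brack n-j}_{q^2}\big(V_j(x)+V_{j-1}(x)\big). \]
   Context: $(a;q)_n=\prod_{k=0}^{n-1}(1-aq^k)$. The Gaussian polynomial is ${n\brack k}_q=\frac{(q;q)_n}{(q;q)_k(q;q)_{n-k}}$ for $0\le k\le n$ and $0$ otherwise; ${n\brack k}_{q^2}$ is the same with $q$ replaced by $q^2$. $V_n(x)$ is the Chebyshev polynomial of the third kind: $V_0(x)=1$, $V_1(x)=2x-1$, $V_n(x)=2xV_{n-1}(x)-V_{n-2}(x)$ for $n>1$, and $V_n(x)=0$ for $n<0$. *)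

theory Defs
  imports "HOL-Computational_Algebra.Polynomial" "HOL-Computational_Algebra.Fraction_Field"
begin

text \<open>Rational functions in \<open>q\<close> over a field \<open>'a\<close> are the type \<open>'a poly fract\<close>; polynomials in \<open>x\<close>
  over these are \<open>'a poly fract poly\<close>.\<close>

definition q_indet :: "'a::field poly fract" where
  "q_indet = Fract [:0, 1:] 1"

definition x_indet :: "'b::comm_ring_1 poly" where
  "x_indet = [:0, 1:]"

definition q_pochhammer :: "'b::comm_ring_1 \<Rightarrow> 'b \<Rightarrow> nat \<Rightarrow> 'b" where
  "q_pochhammer a q n = (\<Prod>k<n. 1 - a * q ^ k)"

definition gauss_binom :: "'b::field \<Rightarrow> nat \<Rightarrow> int \<Rightarrow> 'b" where
  "gauss_binom q n k =
    (if 0 \<le> k \<and> k \<le> int n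
     then q_pochhammer q q n / (q_pochhammer q q (nat k) * q_pochhammer q q (n - nat k))
     else 0)"

fun chebyshev_V_nat :: "nat \<Rightarrow> 'b::comm_ring_1 poly" where
  "chebyshev_V_nat 0 = 1"
| "chebyshev_V_nat (Suc 0) = 2 * x_indet - 1"
| "chebyshev_V_nat (Suc (Suc n)) = 2 * x_indet * chebyshev_V_nat (Suc n) - chebyshev_V_nat n"

definition chebyshev_V :: "int \<Rightarrow> 'b::comm_ring_1 poly" where
  "chebyshev_V n = (if n < 0 then 0 else chebyshev_V_nat (nat n))"

end

theory Submission imports Defs begin

text \<open>Extend \<open>V\<close> to negative indices by the reflection \<open>V (-1 - j) = V j\<close>, so that the three-term
  recurrence \<open>2 x V j = V (j + 1) + V (j - 1)\<close> holds for every integer \<open>j\<close>. Since the coefficients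
  are even in \<open>j\<close>, the right-hand side becomes the two-sided sum of
  \<open>q\<^bsup>j\<^sup>2\<^esup> [2n, n - j] V j\<close> over \<open>-n \<le> j \<le> n\<close>. Multiplying by the next factor of the
  product acts on the coefficients by a recurrence that is two steps of the \<open>q\<close>-Pascal rule.\<close>

section \<open>Gaussian polynomials and the \<open>q\<close>-Pascal rules\<close>

lemma q_pochhammer_0 [simp]: "q_pochhammer a q 0 = 1"
  by (simp add: q_pochhammer_def)

lemma q_pochhammer_Suc [simp]:
  "q_pochhammer a q (Suc n) = q_pochhammer a q n * (1 - a * q ^ n)"
  by (simp add: q_pochhammer_def)

text \<open>The factors are \<open>1 - p ^ Suc k\<close>, so none vanishes when \<open>p\<close> is
  not a root of unity. This is what permits cancelling denominators of
  \<open>gauss_binom\<close>.\<close>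

lemma q_pochhammer_nonzero:
  fixes p :: "'b::field"
  assumes "\<And>k. k > 0 \<Longrightarrow> p ^ k \<noteq> 1"
  shows "q_pochhammer p p n \<noteq> 0"
proof (induction n)
  case (Suc n)
  then show ?case using assms[of "Suc n"] by simp
qed simp

lemma gauss_binom_eq_0: "k < 0 \<or> k > int n \<Longrightarrow> gauss_binom p n k = 0"
  by (auto simp: gauss_binom_def)

lemma gauss_binom_of_nat_add:
  "gauss_binom p (a + b) (int a) =
    q_pochhammer p p (a + b) / (q_pochhammer p p a * q_pochhammer p p b)"
  by (simp add: gauss_binom_def)

lemma gauss_binom_symmetric: "gauss_binom p n (int n - k) = gauss_binom p n k"
proof (cases "0 \<le> k \<and> k \<le> int n")
  case True
  then obtain a where "k = int a" "a \<le> n" by (metis nat_0_le nat_le_iff)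
  then obtain b where n: "n = a + b" and k: "k = int a" using le_Suc_ex by blast
  have "gauss_binom p (b + a) (int b) = gauss_binom p (a + b) (int a)"
    unfolding gauss_binom_of_nat_add by (simp add: ac_simps)
  then show ?thesis by (simp add: n k add.commute)
qed (auto simp: gauss_binom_def)

text \<open>For \<open>1 \<le> k \<le> n\<close> the rule comes from splitting the top factor,
  \<open>1 - p ^ (n + 1) = (1 - p ^ k) + p ^ k * (1 - p ^ (n + 1 - k))\<close>. For
  \<open>k < 0\<close> the truncated exponent \<open>nat k\<close> is harmless, as its binomial is
  0.\<close>

lemma gauss_binom_Suc:
  fixes p :: "'b::field"
  assumes p: "\<And>k. k > 0 \<Longrightarrow> p ^ k \<noteq> 1"
  shows "gauss_binom p (Suc n) k = gauss_binom p n (k - 1) + p ^ nat k * gauss_binom p n k"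
proof -
  note nz = q_pochhammer_nonzero[of p, OF p]
  consider "k < 0 \<or> k > int (Suc n)" | "k = 0" | "k = int (Suc n)" | "1 \<le> k" "k \<le> int n"
    by linarith
  then show ?thesis
  proof cases
    case 1
    then show ?thesis by (auto simp: gauss_binom_eq_0)
  next
    case 2
    then show ?thesis using nz[of n] nz[of "Suc n"] by (simp add: gauss_binom_def)
  next
    case 3
    then show ?thesis using nz[of n] nz[of "Suc n"] by (auto simp: gauss_binom_def nat_add_distrib)
  next
    case 4
    \<comment> \<open>With \<open>k = a + 1\<close> and \<open>n = a + 1 + b\<close> all three
      binomials have denominators built from the indices \<open>a\<close>, \<open>a + 1\<close>,
      \<open>b\<close>, \<open>b + 1\<close>, free of subtraction.\<close>
    define a where "a = nat (k - 1)"
    define b where "b = nat (int n - k)"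
    have k: "k = int (Suc a)" and n: "n = Suc a + b" using 4 by (auto simp: a_def b_def)
    let ?P = "q_pochhammer p p"
    have nza: "1 - p * p ^ a \<noteq> 0" and nzb: "1 - p * p ^ b \<noteq> 0"
      using p[of "Suc a"] p[of "Suc b"] by auto
    have "gauss_binom p (Suc n) k = ?P (Suc a + b) * (1 - p * p ^ (Suc a + b))
        / (?P a * (1 - p * p ^ a) * (?P b * (1 - p * p ^ b)))"
      using gauss_binom_of_nat_add[of p "Suc a" "Suc b"] by (simp add: n k)
    also have "\<dots> = ?P (Suc a + b) / (?P a * (?P b * (1 - p * p ^ b)))
        + p ^ Suc a * (?P (Suc a + b) / (?P a * (1 - p * p ^ a) * ?P b))"
    proof -
      have *: "1 - p * p ^ (Suc a + b) = (1 - p * p ^ a) + p ^ Suc a * (1 - p * p ^ b)"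
        by (simp add: algebra_simps power_add)
      show ?thesis unfolding * using nza nzb nz[of a] nz[of b]
        by (simp add: add_divide_distrib distrib_left ac_simps)
    qed
    also have "?P (Suc a + b) / (?P a * (?P b * (1 - p * p ^ b))) = gauss_binom p n (k - 1)"
      using gauss_binom_of_nat_add[of p a "Suc b"] by (simp add: n k)
    also have "?P (Suc a + b) / (?P a * (1 - p * p ^ a) * ?P b) = gauss_binom p n k"
      using gauss_binom_of_nat_add[of p "Suc a" b] by (simp add: n k)
    finally show ?thesis by (simp add: k nat_add_distrib)
  qed
qed

text \<open>The mirror image of the first rule under \<open>k \<mapsto> n + 1 - k\<close>.\<close>

lemma gauss_binom_Suc':
  fixes p :: "'b::field"
  assumes p: "\<And>k. k > 0 \<Longrightarrow> p ^ k \<noteq> 1"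
  shows "gauss_binom p (Suc n) k =
    gauss_binom p n k + p ^ nat (int n + 1 - k) * gauss_binom p n (k - 1)"
  using gauss_binom_Suc[of p n "int (Suc n) - k", OF p]
    gauss_binom_symmetric[of p "Suc n" k] gauss_binom_symmetric[of p n k]
    gauss_binom_symmetric[of p n "k - 1"]
  by (simp add: algebra_simps)

text \<open>The first Pascal rule is applied to the outer step and its mirror image to the inner
  one; the two resulting multiples of \<open>gauss_binom p n (k - 1)\<close> merge into
  \<open>1 + p ^ (n + 1)\<close>.\<close>

lemma gauss_binom_Suc_Suc:
  fixes p :: "'b::field"
  assumes p: "\<And>k. k > 0 \<Longrightarrow> p ^ k \<noteq> 1"
  shows "gauss_binom p (Suc (Suc n)) k =
    (1 + p ^ (n + 1)) * gauss_binom p n (k - 1) + p ^ nat k * gauss_binom p n k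
      + p ^ nat (int n + 2 - k) * gauss_binom p n (k - 2)"
proof -
  \<comment> \<open>The exponents add up to \<open>n + 1\<close> only where \<open>nat\<close> does
    not truncate; elsewhere the binomial is 0.\<close>
  have *: "p ^ nat k * (p ^ nat (int n + 1 - k) * gauss_binom p n (k - 1)) =
      p ^ (n + 1) * gauss_binom p n (k - 1)"
  proof (cases "0 \<le> k \<and> k \<le> int n + 1")
    case True
    then have "nat k + nat (int n + 1 - k) = n + 1" by linarith
    then show ?thesis by (metis mult.assoc power_add)
  qed (auto simp: gauss_binom_eq_0)
  have "gauss_binom p (Suc (Suc n)) k =
      gauss_binom p (Suc n) (k - 1) + p ^ nat k * gauss_binom p (Suc n) k"
    by (rule gauss_binom_Suc[OF p])
  also have "gauss_binom p (Suc n) (k - 1) =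
      gauss_binom p n (k - 1) + p ^ nat (int n + 2 - k) * gauss_binom p n (k - 2)"
    using gauss_binom_Suc'[of p n "k - 1", OF p] by (simp add: algebra_simps)
  also have "gauss_binom p (Suc n) k =
      gauss_binom p n k + p ^ nat (int n + 1 - k) * gauss_binom p n (k - 1)"
    by (rule gauss_binom_Suc'[OF p])
  finally show ?thesis using * by (simp only: distrib_left distrib_right mult_1) (simp add: ac_simps)
qed

section \<open>Coefficients of the finite triple product\<close>

text \<open>The coefficient of \<open>z ^ j\<close> in the finite Jacobi triple product, the case
  \<open>2 * x = z + 1 / z\<close> of the product studied here; hence the integer index.\<close>

definition triple_coeff :: "'b::field \<Rightarrow> nat \<Rightarrow> int \<Rightarrow> 'b" where
  "triple_coeff q n j = q ^ nat (j\<^sup>2) * gauss_binom (q\<^sup>2) (2 * n) (int n - j)"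

lemma triple_coeff_eq_0: "\<bar>j\<bar> > int n \<Longrightarrow> triple_coeff q n j = 0"
  by (auto simp: triple_coeff_def gauss_binom_def)

lemma triple_coeff_minus: "triple_coeff q n (- j) = triple_coeff q n j"
  using gauss_binom_symmetric[of "q\<^sup>2" "2 * n" "int n - j"] by (simp add: triple_coeff_def)

text \<open>The two-step Pascal rule in base \<open>q\<^sup>2\<close> at
  \<open>k = n + 1 - j\<close>. The powers match because \<open>j\<^sup>2 + 2 * (n + 1 \<mp> j) = (j
  \<mp> 1)\<^sup>2 + 2 * n + 1\<close>.\<close>

lemma triple_coeff_Suc:
  fixes q :: "'b::field"
  assumes q: "\<And>k. k > 0 \<Longrightarrow> q ^ k \<noteq> 1"
  shows "triple_coeff q (Suc n) j = (1 + q ^ (4 * n + 2)) * triple_coeff q n j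
    + q ^ (2 * n + 1) * (triple_coeff q n (j - 1) + triple_coeff q n (j + 1))"
proof -
  let ?G = "gauss_binom (q\<^sup>2) (2 * n)"
  define k where "k = int n + 1 - j"
  have p: "(q\<^sup>2) ^ i \<noteq> 1" if "i > 0" for i
    using q[of "2 * i"] that by (simp add: power_mult)
  \<comment> \<open>Exponents are balanced over the integers; \<open>m\<close> may be negative only
    when the binomial \<open>g\<close> is 0.\<close>
  have shift: "q ^ (2 * n + 1) * (q ^ nat (l\<^sup>2) * g) = q ^ nat (j\<^sup>2) * ((q\<^sup>2) ^ nat m * g)"
    if "g \<noteq> 0 \<Longrightarrow> 0 \<le> m" "2 * int n + 1 + l\<^sup>2 = j\<^sup>2 + 2 * m" for l m :: int and g
  proof (cases "g = 0")
    case False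
    then have "int (2 * n + 1 + nat (l\<^sup>2)) = int (nat (j\<^sup>2) + 2 * nat m)" using that by simp
    then have "2 * n + 1 + nat (l\<^sup>2) = nat (j\<^sup>2) + 2 * nat m" by linarith
    then have "q ^ (2 * n + 1) * q ^ nat (l\<^sup>2) = q ^ nat (j\<^sup>2) * (q\<^sup>2) ^ nat m"
      by (simp only: power_add[symmetric] power_mult[symmetric])
    then show ?thesis by (simp only: mult.assoc[symmetric])
  qed simp
  have 1: "q ^ (2 * n + 1) * triple_coeff q n (j - 1) = q ^ nat (j\<^sup>2) * ((q\<^sup>2) ^ nat k * ?G k)"
    unfolding triple_coeff_def k_def
    using shift[of "?G k" k "j - 1"] gauss_binom_eq_0[of k "2 * n" "q\<^sup>2"]
    by (force simp: k_def algebra_simps power2_eq_square)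
  have 2: "q ^ (2 * n + 1) * triple_coeff q n (j + 1) =
      q ^ nat (j\<^sup>2) * ((q\<^sup>2) ^ nat (int (2 * n) + 2 - k) * ?G (k - 2))"
    unfolding triple_coeff_def k_def
    using shift[of "?G (k - 2)" "int (2 * n) + 2 - k" "j + 1"]
      gauss_binom_eq_0[of "k - 2" "2 * n" "q\<^sup>2"]
    by (force simp: k_def algebra_simps power2_eq_square)
  have e: "(q\<^sup>2) ^ (2 * n + 1) = q ^ (4 * n + 2)"
    by (simp only: power_mult[symmetric]) (simp add: algebra_simps)
  have "triple_coeff q (Suc n) j = q ^ nat (j\<^sup>2) * gauss_binom (q\<^sup>2) (Suc (Suc (2 * n))) k"
    by (simp add: triple_coeff_def k_def algebra_simps)
  also have "\<dots> = (1 + q ^ (4 * n + 2)) * (q ^ nat (j\<^sup>2) * ?G (k - 1))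
      + q ^ nat (j\<^sup>2) * ((q\<^sup>2) ^ nat k * ?G k)
      + q ^ nat (j\<^sup>2) * ((q\<^sup>2) ^ nat (int (2 * n) + 2 - k) * ?G (k - 2))"
    by (subst gauss_binom_Suc_Suc[OF p], assumption) (unfold e, simp only: distrib_left distrib_right mult_1 ac_simps)
  also have "q ^ nat (j\<^sup>2) * ?G (k - 1) = triple_coeff q n j"
    by (simp add: triple_coeff_def k_def)
  finally show ?thesis by (simp only: 1[symmetric] 2[symmetric] distrib_left add.assoc)
qed

section \<open>Chebyshev polynomials reflected to negative indices\<close>

definition chebyshev_V_refl :: "int \<Rightarrow> 'b::comm_ring_1 poly" where
  "chebyshev_V_refl j = chebyshev_V (if j < 0 then - 1 - j else j)"

lemma chebyshev_V_recurrence: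
  assumes "j \<ge> 1"
  shows "2 * x_indet * chebyshev_V j = chebyshev_V (j + 1) + chebyshev_V (j - 1)"
proof -
  define m where "m = nat (j - 1)"
  have "nat j = Suc m" "nat (j + 1) = Suc (Suc m)" "nat (j - 1) = m"
    using assms by (auto simp: m_def)
  then show ?thesis using assms by (simp add: chebyshev_V_def)
qed

text \<open>The reflection maps the recurrence for \<open>j \<ge> 1\<close> to
  \<open>j \<le> - 2\<close>. At \<open>j = 0\<close> and \<open>j = - 1\<close> it reads
  \<open>2 * x = (2 * x - 1) + 1\<close>, since the reflected value at \<open>- 1\<close> is 1,
  whereas \<open>chebyshev_V (- 1)\<close> is 0.\<close>

lemma chebyshev_V_refl_recurrence:
  "2 * x_indet * chebyshev_V_refl j = chebyshev_V_refl (j + 1) + chebyshev_V_refl (j - 1)"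
proof -
  consider "j \<ge> 1" | "j = 0" | "j = - 1" | "j \<le> - 2" by linarith
  then show ?thesis
  proof cases
    case 1
    then show ?thesis using chebyshev_V_recurrence[of j] by (simp add: chebyshev_V_refl_def)
  next
    case 4
    then show ?thesis using chebyshev_V_recurrence[of "- 1 - j"]
      by (simp add: chebyshev_V_refl_def algebra_simps)
  qed (simp_all add: chebyshev_V_refl_def chebyshev_V_def)
qed

lemma sum_symmetric_interval:
  fixes f :: "int \<Rightarrow> 'b::comm_monoid_add"
  shows "(\<Sum>j=-int n..int n. f j) = f 0 + (\<Sum>j=1..n. f (int j) + f (- int j))"
proof (induction n)
  case (Suc n)
  have "{-int (Suc n)..int (Suc n)} = insert (int (Suc n)) (insert (- int (Suc n)) {-int n..int n})"
    by auto
  then show ?case using Suc by (simp add: ac_simps)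
qed simp

text \<open>The indices \<open>j\<close> and \<open>- j\<close> share a coefficient, and for
  \<open>j \<ge> 1\<close> the reflection sends \<open>- j\<close> to \<open>j - 1\<close>.\<close>

lemma sum_triple_coeff_chebyshev:
  fixes q :: "'b::field"
  shows "(\<Sum>j=-int n..int n. [:triple_coeff q n j:] * chebyshev_V_refl j) =
    (\<Sum>j=0..n. [:triple_coeff q n (int j):] * (chebyshev_V (int j) + chebyshev_V (int j - 1)))"
proof -
  have "(\<Sum>j=-int n..int n. [:triple_coeff q n j:] * chebyshev_V_refl j) =
      [:triple_coeff q n 0:] * chebyshev_V 0 +
      (\<Sum>j=1..n. [:triple_coeff q n (int j):] * (chebyshev_V (int j) + chebyshev_V (int j - 1)))"
    unfolding sum_symmetric_interval
    by (intro arg_cong2[where f = "(+)"] sum.cong refl)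
      (auto simp: triple_coeff_minus chebyshev_V_refl_def distrib_left)
  \<comment> \<open>The unpaired central term fits the general pattern because
    \<open>chebyshev_V (- 1) = 0\<close>.\<close>
  also have "[:triple_coeff q n 0:] * chebyshev_V 0 =
      [:triple_coeff q n (int 0):] * (chebyshev_V (int 0) + chebyshev_V (int 0 - 1))"
    by (simp add: chebyshev_V_def)
  finally show ?thesis by (simp add: sum.atLeast_Suc_atMost)
qed

section \<open>Expansion of the product\<close>

lemma prod_eq_sum_triple_coeff:
  fixes q :: "'b::field"
  assumes q: "\<And>k. k > 0 \<Longrightarrow> q ^ k \<noteq> 1"
  shows "(\<Prod>j=1..n. 1 + 2 * x_indet * [:q ^ (2 * j - 1):] + [:q ^ (4 * j - 2):]) =
    (\<Sum>j=-int n..int n. [:triple_coeff q n j:] * chebyshev_V_refl j)"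
proof (induction n)
  case 0
  show ?case
    by (simp add: triple_coeff_def gauss_binom_def chebyshev_V_refl_def chebyshev_V_def one_pCons)
next
  case (Suc n)
  let ?V = chebyshev_V_refl and ?c = "\<lambda>j. [:triple_coeff q n j:]"
  let ?I = "{-int (Suc n)..int (Suc n)}"
  \<comment> \<open>The coefficients vanish for \<open>\<bar>j\<bar> > n\<close>, so this sum and
    its two index shifts can all be taken over \<open>?I\<close> and compared termwise.\<close>
  have V0: "(\<Sum>j=-int n..int n. ?c j * ?V j) = (\<Sum>j\<in>?I. ?c j * ?V j)"
    by (rule sum.mono_neutral_left) (auto simp: triple_coeff_eq_0)
  have "(\<Sum>j=-int n..int n. ?c j * ?V (j + 1)) =
      (\<Sum>j=-int n+1..int n+1. ?c (j - 1) * ?V j)"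
    by (rule sum.reindex_bij_witness[of _ "\<lambda>j. j - 1" "\<lambda>j. j + 1"]) auto
  also have "\<dots> = (\<Sum>j\<in>?I. ?c (j - 1) * ?V j)"
    by (rule sum.mono_neutral_left) (auto simp: triple_coeff_eq_0)
  finally have V1: "(\<Sum>j=-int n..int n. ?c j * ?V (j + 1)) = (\<Sum>j\<in>?I. ?c (j - 1) * ?V j)" .
  have "(\<Sum>j=-int n..int n. ?c j * ?V (j - 1)) =
      (\<Sum>j=-int n-1..int n-1. ?c (j + 1) * ?V j)"
    by (rule sum.reindex_bij_witness[of _ "\<lambda>j. j + 1" "\<lambda>j. j - 1"]) auto
  also have "\<dots> = (\<Sum>j\<in>?I. ?c (j + 1) * ?V j)"
    by (rule sum.mono_neutral_left) (auto simp: triple_coeff_eq_0)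
  finally have V2: "(\<Sum>j=-int n..int n. ?c j * ?V (j - 1)) = (\<Sum>j\<in>?I. ?c (j + 1) * ?V j)" .
  have "(\<Sum>j=-int n..int n. ?c j * ?V j) * (2 * x_indet) =
      (\<Sum>j=-int n..int n. ?c j * (2 * x_indet * ?V j))"
    by (simp add: sum_distrib_right sum_distrib_left ac_simps)
  also have "\<dots> = (\<Sum>j\<in>?I. ?c (j - 1) * ?V j) + (\<Sum>j\<in>?I. ?c (j + 1) * ?V j)"
    unfolding chebyshev_V_refl_recurrence distrib_left sum.distrib V1 V2 ..
  finally have X: "(\<Sum>j=-int n..int n. ?c j * ?V j) * (2 * x_indet) =
      (\<Sum>j\<in>?I. ?c (j - 1) * ?V j) + (\<Sum>j\<in>?I. ?c (j + 1) * ?V j)" .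
  have c: "[:triple_coeff q (Suc n) j:] = (1 + [:q ^ (4 * n + 2):]) * ?c j
      + [:q ^ (2 * n + 1):] * (?c (j - 1) + ?c (j + 1))" for j
    by (subst triple_coeff_Suc[OF q], assumption) (simp add: one_pCons)
  have "(\<Prod>j=1..Suc n. 1 + 2 * x_indet * [:q ^ (2 * j - 1):] + [:q ^ (4 * j - 2):]) =
      (\<Sum>j=-int n..int n. ?c j * ?V j)
        * (1 + 2 * x_indet * [:q ^ (2 * n + 1):] + [:q ^ (4 * n + 2):])"
    using Suc by simp
  also have "\<dots> = (1 + [:q ^ (4 * n + 2):]) * (\<Sum>j=-int n..int n. ?c j * ?V j)
      + [:q ^ (2 * n + 1):] * ((\<Sum>j=-int n..int n. ?c j * ?V j) * (2 * x_indet))"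
    by (simp only: distrib_left distrib_right mult_1 mult_1_right ac_simps)
  also have "\<dots> = (\<Sum>j\<in>?I. ((1 + [:q ^ (4 * n + 2):]) * ?c j
      + [:q ^ (2 * n + 1):] * (?c (j - 1) + ?c (j + 1))) * ?V j)"
    unfolding X unfolding V0
    by (simp only: sum_distrib_left sum.distrib distrib_left distrib_right mult.assoc)
  finally show ?case unfolding c .
qed

section \<open>Specialization to the indeterminate \<open>q\<close>\<close>

lemma q_indet_power: "(q_indet :: 'a::field poly fract) ^ k = Fract (monom 1 k) 1"
  by (induction k) (simp_all add: q_indet_def One_fract_def monom_Suc)

text \<open>A monomial of degree \<open>k > 0\<close> is not constant, so the indeterminate is not a
  root of unity and the general expansion applies to it.\<close>

lemma q_indet_power_neq_1:
  assumes "k > 0"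
  shows "(q_indet :: 'a::field poly fract) ^ k \<noteq> 1"
proof
  assume "(q_indet :: 'a poly fract) ^ k = 1"
  then have "monom (1::'a) k = 1"
    by (simp add: q_indet_power One_fract_def eq_fract)
  then have "degree (monom (1::'a) k) = 0" by simp
  then show False using assms by (simp add: degree_monom_eq)
qed

theorem theorem3p1:
  fixes n :: nat
  shows "(\<Prod>j=1..n. 1 + 2 * x_indet * [:q_indet ^ (2 * j - 1):] + [:q_indet ^ (4 * j - 2):])
       = (\<Sum>j=0..n. [:q_indet ^ (j\<^sup>2) * gauss_binom (q_indet\<^sup>2) (2 * n) (int n - int j):]
            * (chebyshev_V (int j) + chebyshev_V (int j - 1)) :: 'a::field_char_0 poly fract poly)"
  using prod_eq_sum_triple_coeff[of "q_indet :: 'a poly fract" n, OF q_indet_power_neq_1]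
  unfolding sum_triple_coeff_chebyshev
  by (simp add: triple_coeff_def nat_power_eq)

end
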